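(* Let $m\geq 1$ be an integer and $J\subseteq[2m-1]$. Then $$\sum_{\sigma\in S_{2m}^{J}} (-1)^{\ell(\sigma)}q_{1}^{\mathrm{omaj}(\sigma)} q_{2}^{\mathrm{emaj}(\sigma)} x_{1}^{\mathrm{odes}(\sigma)} x_{2}^{\mathrm{edes}(\sigma)}=\prod_{\{i\in[m]:\ 2i-1\notin J\}}(1-x_1q_1^{i})\ \sum_{\tau\in S_{m}^{J_e/2}} q_{2}^{\mathrm{maj}(\tau)}x_{2}^{\mathrm{des}(\tau)}.$$
   Context: $S_n$ is the group of bijections of $[n]=\{1,\dots,n\}$. For $\sigma\in S_n$: $\ell(\sigma)$ is the number of inversions, i.e. of pairs $i<j$ in $[n]$ with $\sigma(i)>\sigma(j)$; $D(\sigma)=\{i\in[n-1]:\sigma(i)>\sigma(i+1)\}$; $\mathrm{des}(\sigma)=|D(\sigma)|$, $\mathrm{maj}(\sigma)=\sum_{i\in D(\sigma)}i$; $D(\sigma)_o$ and $D(\sigma)_e$ are the sets of odd, respectively even, elements of $D(\sigma)$; $\mathrm{odes}(\sigma)=|D(\sigma)_o|$, $\mathrm{edes}(\sigma)=|D(\sigma)_e|$, $\mathrm{omaj}(\sigma)=\sum_{i\in D(\sigma)_o}\frac{i+1}{2}$, $\mathrm{emaj}(\sigma)=\sum_{i\in D(\sigma)_e}\frac{i}{2}$. For $J\subseteq[n-1]$, $S_n^J=\{\sigma\in S_n:\sigma(i)<\sigma(i+1)\ \text{for all } i\in J\}$. For $J\subseteq [2m-1]$, $J_e/2=\{j/2: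 j\in J,\ j \text{ even}\}\subseteq[m-1]$. The variables $q_1,q_2,x_1,x_2$ are commuting indeterminates, and empty products equal $1$. *)

theory Defs
  imports Main "HOL-Combinatorics.Permutations"
begin

text \<open>
  An element of the symmetric group on \<open>[n] = {1..n}\<close> is represented by a function
  \<open>\<sigma> :: nat \<Rightarrow> nat\<close> with \<open>\<sigma> permutes {1..n}\<close> (fixing every point outside \<open>[n]\<close>). Since the
  type does not record \<open>n\<close>, the statistics below take it as their first argument.

  The commuting indeterminates of the generating functions are rendered as arbitrary elements of
  an arbitrary commutative ring with 1; taking the variables of a polynomial ring over the
  integers gives the polynomial identity itself.
\<close>

definition inversions :: "nat \<Rightarrow> (nat \<Rightarrow> nat) \<Rightarrow> (nat \<times> nat) set" where
  "inversions n \<sigma> = {(i, j). i \<in> {1..n} \<and> j \<in> {1..n} \<and> i < j \<and> \<sigma> i > \<sigma> j}"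

definition inv_length :: "nat \<Rightarrow> (nat \<Rightarrow> nat) \<Rightarrow> nat" where
  "inv_length n \<sigma> = card (inversions n \<sigma>)"

definition descents :: "nat \<Rightarrow> (nat \<Rightarrow> nat) \<Rightarrow> nat set" where
  "descents n \<sigma> = {i \<in> {1..n - 1}. \<sigma> i > \<sigma> (i + 1)}"

definition des :: "nat \<Rightarrow> (nat \<Rightarrow> nat) \<Rightarrow> nat" where
  "des n \<sigma> = card (descents n \<sigma>)"

definition maj :: "nat \<Rightarrow> (nat \<Rightarrow> nat) \<Rightarrow> nat" where
  "maj n \<sigma> = (\<Sum>i\<in>descents n \<sigma>. i)"

definition odd_descents :: "nat \<Rightarrow> (nat \<Rightarrow> nat) \<Rightarrow> nat set" where
  "odd_descents n \<sigma> = {i \<in> descents n \<sigma>. odd i}"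

definition even_descents :: "nat \<Rightarrow> (nat \<Rightarrow> nat) \<Rightarrow> nat set" where
  "even_descents n \<sigma> = {i \<in> descents n \<sigma>. even i}"

definition odes :: "nat \<Rightarrow> (nat \<Rightarrow> nat) \<Rightarrow> nat" where
  "odes n \<sigma> = card (odd_descents n \<sigma>)"

definition edes :: "nat \<Rightarrow> (nat \<Rightarrow> nat) \<Rightarrow> nat" where
  "edes n \<sigma> = card (even_descents n \<sigma>)"

text \<open>The divisions by 2 in the next three definitions are exact, by the parity of the index.\<close>

definition omaj :: "nat \<Rightarrow> (nat \<Rightarrow> nat) \<Rightarrow> nat" where
  "omaj n \<sigma> = (\<Sum>i\<in>odd_descents n \<sigma>. (i + 1) div 2)"

definition emaj :: "nat \<Rightarrow> (nat \<Rightarrow> nat) \<Rightarrow> nat" where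
  "emaj n \<sigma> = (\<Sum>i\<in>even_descents n \<sigma>. i div 2)"

definition even_half :: "nat set \<Rightarrow> nat set" where
  "even_half J = {j div 2 | j. j \<in> J \<and> even j}"

definition sym_quot :: "nat \<Rightarrow> nat set \<Rightarrow> (nat \<Rightarrow> nat) set" where
  "sym_quot n J = {\<sigma>. \<sigma> permutes {1..n} \<and> (\<forall>i\<in>J. \<sigma> i < \<sigma> (i + 1))}"

end

theory Submission
  imports Defs
begin

text \<open>
  Group the values \<open>1..2 * m\<close> into the pairs \<open>{2 * k - 1, 2 * k}\<close>. If the two values of a pair sit
  at positions that are not adjacent, exchanging them affects no comparison except the one between
  these two positions: the descent set is unchanged, and the number of inversions changes by
  exactly one. Performing this exchange for the least such \<open>k\<close> is an involution that flips the sign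
  and keeps every other factor of the summand, as well as membership in the quotient, since all of
  these are determined by the descent set. So the permutations in which some pair is split
  cancel (\<open>sum_weight_split_eq_0\<close>).

  In a surviving permutation the position sets of the pairs tile \<open>1..2 * m\<close> by dominoes of
  adjacent positions. The only such tiling is \<open>{1, 2}, {3, 4}, \<dots>\<close>, so a survivor is given by a
  permutation \<open>\<tau>\<close> of \<open>1..m\<close> (domino \<open>i\<close> carries the pair number \<open>\<tau> i\<close>) and the set \<open>T\<close> of dominoes
  whose two values appear in decreasing order (\<open>bij_betw_domino_perm\<close>). Odd descents then record
  \<open>T\<close>, even descents record the descents of \<open>\<tau>\<close>, and the sign is \<open>(-1) ^ card T\<close>, because an
  inversion of \<open>\<tau>\<close> contributes four inversions and a reversed domino one. The weight therefore
  splits into a factor for \<open>\<tau>\<close> and a factor for \<open>T\<close> (\<open>weight_domino_perm\<close>), and the condition imposed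
  by \<open>J\<close> splits as well: \<open>\<tau>\<close> has no descent in \<open>even_half J\<close>, and \<open>T\<close> avoids the \<open>i\<close> with
  \<open>2 * i - 1 \<in> J\<close>. Summing over \<open>T\<close> gives the product.
\<close>

section \<open>Exchanging two consecutive values\<close>

text \<open>No value lies strictly between \<open>v\<close> and \<open>Suc v\<close>, so exchanging them is invisible to every other
  comparison.\<close>

lemma transpose_Suc_less_iff:
  fixes x y v :: nat
  assumes "{x, y} \<noteq> {v, Suc v}"
  shows "transpose v (Suc v) x < transpose v (Suc v) y \<longleftrightarrow> x < y"
  using assms by (auto simp: transpose_def)

lemma inj_pair_eq_iff:
  assumes "inj \<sigma>" "\<sigma> a = v" "\<sigma> b = w"
  shows "{\<sigma> x, \<sigma> y} = {v, w} \<longleftrightarrow> {x, y} = {a, b}"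
  using assms by (auto simp: doubleton_eq_iff inj_eq)

text \<open>Descents compare adjacent positions only, hence never the two exchanged values.\<close>

lemma descents_transpose_values:
  assumes "\<sigma> permutes {1..n}" "\<sigma> a = v" "\<sigma> b = Suc v" "Suc a \<noteq> b" "Suc b \<noteq> a"
  shows "descents n (transpose v (Suc v) \<circ> \<sigma>) = descents n \<sigma>"
proof -
  have "{\<sigma> (i + 1), \<sigma> i} \<noteq> {v, Suc v}" for i
    using inj_pair_eq_iff[OF permutes_inj[OF assms(1)] assms(2,3)] assms(4,5)
    by (auto simp: doubleton_eq_iff)
  then show ?thesis
    by (auto simp: descents_def transpose_Suc_less_iff)
qed

lemma finite_inversions [simp]: "finite (inversions n \<sigma>)"
  by (rule finite_subset[of _ "{1..n} \<times> {1..n}"]) (auto simp: inversions_def)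

lemma inv_length_transpose_values:
  assumes \<sigma>: "\<sigma> permutes {1..n}" and ab: "\<sigma> a = v" "\<sigma> b = Suc v" "a < b" "a \<in> {1..n}" "b \<in> {1..n}"
  shows "inv_length n (transpose v (Suc v) \<circ> \<sigma>) = Suc (inv_length n \<sigma>)"
proof -
  have less_iff: "transpose v (Suc v) (\<sigma> j) < transpose v (Suc v) (\<sigma> i) \<longleftrightarrow> \<sigma> j < \<sigma> i"
    if "i < j" "(i, j) \<noteq> (a, b)" for i j
  proof -
    have "{\<sigma> j, \<sigma> i} \<noteq> {v, Suc v}"
      using inj_pair_eq_iff[OF permutes_inj[OF \<sigma>] ab(1,2)] that ab(3)
      by (auto simp: doubleton_eq_iff)
    then show ?thesis
      by (rule transpose_Suc_less_iff)
  qed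
  have "inversions n (transpose v (Suc v) \<circ> \<sigma>) = insert (a, b) (inversions n \<sigma>)"
  proof (rule set_eqI, clarify)
    fix i j
    show "(i, j) \<in> inversions n (transpose v (Suc v) \<circ> \<sigma>)
      \<longleftrightarrow> (i, j) \<in> insert (a, b) (inversions n \<sigma>)"
      using less_iff[of i j] ab by (cases "(i, j) = (a, b)") (auto simp: inversions_def)
  qed
  moreover have "(a, b) \<notin> inversions n \<sigma>"
    using ab by (simp add: inversions_def)
  ultimately show ?thesis
    by (simp add: inv_length_def)
qed

lemma even_inv_length_transpose_values:
  assumes "\<sigma> permutes {1..n}" "v \<in> {1..n}" "Suc v \<in> {1..n}"
  shows "even (inv_length n (transpose v (Suc v) \<circ> \<sigma>)) \<longleftrightarrow> odd (inv_length n \<sigma>)"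
proof -
  obtain a b where ab: "\<sigma> a = v" "\<sigma> b = Suc v" "a \<in> {1..n}" "b \<in> {1..n}"
    using assms permutes_image[OF assms(1)] by (metis imageE)
  consider "a < b" | "b < a"
    using ab by (metis linorder_neqE_nat n_not_Suc_n)
  then show ?thesis
  proof cases
    case 1
    then show ?thesis
      using inv_length_transpose_values[OF assms(1) ab(1,2)] ab by simp
  next
    case 2
    \<comment> \<open>Now the exchange removes an inversion, so the count is applied to the exchanged permutation.\<close>
    let ?\<rho> = "transpose v (Suc v) \<circ> \<sigma>"
    have "?\<rho> permutes {1..n}"
      using assms by (intro permutes_compose permutes_swap_id)
    then have "inv_length n (transpose v (Suc v) \<circ> ?\<rho>) = Suc (inv_length n ?\<rho>)"
      using 2 ab by (intro inv_length_transpose_values[of _ _ b _ a]) auto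
    then show ?thesis
      by (simp flip: o_assoc add: o_assoc)
  qed
qed

section \<open>Cancellation of the permutations with a split pair\<close>

text \<open>From \<open>f (\<phi> x) = - f x\<close> alone one only gets \<open>2 * sum f A = 0\<close>, which says too little when
  2 is a zero divisor. The predicate \<open>P\<close> distinguishes the two members of each orbit, so that the
  cancellation can be carried out orbit by orbit.\<close>

lemma sum_eq_0_sign_reversing:
  fixes f :: "'b \<Rightarrow> 'a::ab_group_add"
  assumes "finite A"
    and "\<And>x. x \<in> A \<Longrightarrow> \<phi> x \<in> A" "\<And>x. x \<in> A \<Longrightarrow> \<phi> (\<phi> x) = x"
    and "\<And>x. x \<in> A \<Longrightarrow> P (\<phi> x) \<longleftrightarrow> \<not> P x" "\<And>x. x \<in> A \<Longrightarrow> f (\<phi> x) = - f x"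
  shows "sum f A = 0"
proof -
  have bij: "bij_betw \<phi> {x \<in> A. P x} {x \<in> A. \<not> P x}"
    by (rule bij_betw_byWitness[where f' = \<phi>]) (use assms in auto)
  have "sum f {x \<in> A. \<not> P x} = (\<Sum>x | x \<in> A \<and> P x. f (\<phi> x))"
    by (rule sum.reindex_bij_betw[OF bij, symmetric])
  also have "\<dots> = - sum f {x \<in> A. P x}"
    using assms(5) by (simp add: sum_negf[symmetric])
  finally have "sum f {x \<in> A. P x} + sum f {x \<in> A. \<not> P x} = 0"
    by simp
  moreover have "A = {x \<in> A. P x} \<union> {x \<in> A. \<not> P x}"
    by auto
  ultimately show ?thesis
    using assms(1) by (subst \<open>A = _\<close>, subst sum.union_disjoint) auto
qed

definition split_pair :: "(nat \<Rightarrow> nat) \<Rightarrow> nat \<Rightarrow> bool" where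
  "split_pair \<sigma> k \<longleftrightarrow> (\<exists>a b. \<sigma> a = 2 * k - 1 \<and> \<sigma> b = 2 * k \<and> Suc a \<noteq> b \<and> Suc b \<noteq> a)"

definition swap_pair :: "nat \<Rightarrow> (nat \<Rightarrow> nat) \<Rightarrow> nat \<Rightarrow> nat" where
  "swap_pair k \<sigma> = transpose (2 * k - 1) (2 * k) \<circ> \<sigma>"

lemma swap_pair_swap_pair [simp]: "swap_pair k (swap_pair k \<sigma>) = \<sigma>"
  by (simp add: swap_pair_def o_assoc)

text \<open>Exchanging a pair leaves all position sets of pairs as they were; therefore the least split pair
  of a permutation is also the least split pair of its image, which makes the exchange an
  involution.\<close>

lemma split_pair_swap_pair:
  assumes "k \<ge> 1" "l \<ge> 1"
  shows "split_pair (swap_pair k \<sigma>) l \<longleftrightarrow> split_pair \<sigma> l"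
proof (cases "k = l")
  case True
  have "transpose (2 * k - 1) (2 * k) x = 2 * k - 1 \<longleftrightarrow> x = 2 * k"
    "transpose (2 * k - 1) (2 * k) x = 2 * k \<longleftrightarrow> x = 2 * k - 1" for x
    using assms by (auto simp: transpose_def)
  then show ?thesis
    unfolding split_pair_def swap_pair_def comp_def True by metis
next
  case False
  have "2 * l - 1 \<noteq> 2 * k - 1" "2 * l - 1 \<noteq> 2 * k" "2 * l \<noteq> 2 * k - 1" "2 * l \<noteq> 2 * k"
    using assms False by presburger+
  then have "transpose (2 * k - 1) (2 * k) x = 2 * l - 1 \<longleftrightarrow> x = 2 * l - 1"
    "transpose (2 * k - 1) (2 * k) x = 2 * l \<longleftrightarrow> x = 2 * l" for x
    by (auto simp: transpose_def)
  then show ?thesis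
    unfolding split_pair_def swap_pair_def comp_def by metis
qed

definition weight :: "'a::comm_ring_1 \<Rightarrow> 'a \<Rightarrow> 'a \<Rightarrow> 'a \<Rightarrow> nat \<Rightarrow> (nat \<Rightarrow> nat) \<Rightarrow> 'a" where
  "weight q1 q2 x1 x2 n \<sigma> = (-1) ^ inv_length n \<sigma> * q1 ^ omaj n \<sigma> * q2 ^ emaj n \<sigma>
     * x1 ^ odes n \<sigma> * x2 ^ edes n \<sigma>"

text \<open>Membership in the quotient depends on the descent set alone.\<close>

lemma sym_quot_eq:
  assumes "J \<subseteq> {1..n - 1}"
  shows "sym_quot n J = {\<sigma>. \<sigma> permutes {1..n} \<and> descents n \<sigma> \<inter> J = {}}"
proof -
  have "\<sigma> i < \<sigma> (i + 1) \<longleftrightarrow> \<not> \<sigma> i > \<sigma> (i + 1)" if "\<sigma> permutes {1..n}" for \<sigma> i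
    using permutes_inj[OF that] by (metis add_eq_self_zero inj_eq not_less_iff_gr_or_eq one_neq_zero)
  then show ?thesis
    using assms unfolding sym_quot_def descents_def by blast
qed

lemma finite_sym_quot: "finite (sym_quot n J)"
  by (rule finite_subset[OF _ finite_permutations[of "{1..n}"]]) (auto simp: sym_quot_def)

lemma sum_weight_split_eq_0:
  assumes J: "J \<subseteq> {1..2 * m - 1}"
  shows "(\<Sum>\<sigma> | \<sigma> \<in> sym_quot (2 * m) J \<and> (\<exists>k\<in>{1..m}. split_pair \<sigma> k).
           weight q1 q2 x1 x2 (2 * m) \<sigma>) = 0"
    (is "sum _ ?A = 0")
proof -
  define K where "K \<sigma> = (LEAST k. k \<in> {1..m} \<and> split_pair \<sigma> k)" for \<sigma>
  let ?\<phi> = "\<lambda>\<sigma>. swap_pair (K \<sigma>) \<sigma>"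
  have K: "K \<sigma> \<in> {1..m} \<and> split_pair \<sigma> (K \<sigma>)" if "\<sigma> \<in> ?A" for \<sigma>
  proof -
    from that obtain k where "k \<in> {1..m} \<and> split_pair \<sigma> k"
      by blast
    then show ?thesis
      unfolding K_def by (rule LeastI)
  qed
  have K_swap: "K (swap_pair k \<sigma>) = K \<sigma>" if "k \<in> {1..m}" for k \<sigma>
    using that unfolding K_def
    by (intro arg_cong[where f = Least] ext conj_cong) (auto simp: split_pair_swap_pair)
  have perm: "\<sigma> permutes {1..2 * m}" if "\<sigma> \<in> ?A" for \<sigma>
    using that by (simp add: sym_quot_def)
  have Suc_K: "2 * K \<sigma> = Suc (2 * K \<sigma> - 1)" if "\<sigma> \<in> ?A" for \<sigma>
    using K[OF that] by simp
  have perm': "?\<phi> \<sigma> permutes {1..2 * m}" if "\<sigma> \<in> ?A" for \<sigma>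
    using K[OF that] unfolding swap_pair_def
    by (intro permutes_compose[OF perm[OF that]] permutes_swap_id) auto
  have desc: "descents (2 * m) (?\<phi> \<sigma>) = descents (2 * m) \<sigma>" if "\<sigma> \<in> ?A" for \<sigma>
  proof -
    from K[OF that] Suc_K[OF that] obtain a b
      where "\<sigma> a = 2 * K \<sigma> - 1" "\<sigma> b = Suc (2 * K \<sigma> - 1)" "Suc a \<noteq> b" "Suc b \<noteq> a"
      unfolding split_pair_def by metis
    then show ?thesis
      using descents_transpose_values[OF perm[OF that]] Suc_K[OF that]
      unfolding swap_pair_def by metis
  qed
  have parity: "even (inv_length (2 * m) (?\<phi> \<sigma>)) \<longleftrightarrow> \<not> even (inv_length (2 * m) \<sigma>)"
    if "\<sigma> \<in> ?A" for \<sigma>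
  proof -
    have "2 * K \<sigma> - 1 \<in> {1..2 * m}" "Suc (2 * K \<sigma> - 1) \<in> {1..2 * m}"
      using K[OF that] by auto
    from even_inv_length_transpose_values[OF perm[OF that] this] show ?thesis
      using Suc_K[OF that] unfolding swap_pair_def by metis
  qed
  show ?thesis
  proof (rule sum_eq_0_sign_reversing[where \<phi> = ?\<phi> and P = "\<lambda>\<sigma>. even (inv_length (2 * m) \<sigma>)"])
    show "finite ?A"
      using finite_sym_quot by simp
  next
    fix \<sigma> assume A: "\<sigma> \<in> ?A"
    then show "?\<phi> \<sigma> \<in> ?A"
      using perm'[OF A] desc[OF A] K[OF A] by (auto simp: sym_quot_eq[OF J] split_pair_swap_pair)
    show "?\<phi> (?\<phi> \<sigma>) = \<sigma>"
      using K[OF A] by (simp add: K_swap)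
    show "even (inv_length (2 * m) (?\<phi> \<sigma>)) \<longleftrightarrow> \<not> even (inv_length (2 * m) \<sigma>)"
      by (rule parity[OF A])
    show "weight q1 q2 x1 x2 (2 * m) (?\<phi> \<sigma>) = - weight q1 q2 x1 x2 (2 * m) \<sigma>"
      using desc[OF A] parity[OF A]
      by (simp add: weight_def omaj_def emaj_def odes_def edes_def odd_descents_def
          even_descents_def uminus_power_if)
  qed
qed

section \<open>The surviving permutations\<close>

text \<open>Position \<open>j\<close> lies in domino \<open>(j + 1) div 2\<close>, and likewise the value \<open>v\<close> lies in pair
  \<open>(v + 1) div 2\<close>. The formula also covers positions outside \<open>1..2 * m\<close>: if \<open>\<tau>\<close> fixes every point outside
  \<open>1..m\<close> and \<open>T \<subseteq> {1..m}\<close>, it yields \<open>j\<close> there.\<close>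

definition domino_perm :: "(nat \<Rightarrow> nat) \<Rightarrow> nat set \<Rightarrow> nat \<Rightarrow> nat" where
  "domino_perm \<tau> T j = (if odd j \<longleftrightarrow> (j + 1) div 2 \<notin> T
     then 2 * \<tau> ((j + 1) div 2) - 1 else 2 * \<tau> ((j + 1) div 2))"

lemma domino_perm_odd:
  "i \<ge> 1 \<Longrightarrow> domino_perm \<tau> T (2 * i - Suc 0) = (if i \<in> T then 2 * \<tau> i else 2 * \<tau> i - 1)"
  by (auto simp: domino_perm_def)

lemma domino_perm_even: "domino_perm \<tau> T (2 * i) = (if i \<in> T then 2 * \<tau> i - 1 else 2 * \<tau> i)"
  by (auto simp: domino_perm_def)

lemma block_domino_perm: "(domino_perm \<tau> T j + 1) div 2 = \<tau> ((j + 1) div 2)"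
proof -
  have "(2 * x - 1 + 1) div 2 = x" "(2 * x + 1) div 2 = x" for x :: nat
    by presburger+
  then show ?thesis
    by (simp only: domino_perm_def if_distrib[of "\<lambda>x. (x + 1) div 2"] if_cancel)
qed

lemma domino_perm_permutes:
  assumes \<tau>: "\<tau> permutes {1..m}" and T: "T \<subseteq> {1..m}"
  shows "domino_perm \<tau> T permutes {1..2 * m}"
proof -
  have \<tau>_range: "\<tau> i \<in> {1..m}" if "i \<in> {1..m}" for i
    using permutes_in_image[OF \<tau>] that by blast
  have inj: "inj_on (domino_perm \<tau> T) {1..2 * m}"
  proof (rule inj_onI)
    fix i j assume ij: "i \<in> {1..2 * m}" "j \<in> {1..2 * m}" "domino_perm \<tau> T i = domino_perm \<tau> T j"
    then have "\<tau> ((i + 1) div 2) = \<tau> ((j + 1) div 2)"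
      by (metis block_domino_perm)
    then have block: "(i + 1) div 2 = (j + 1) div 2"
      using permutes_inj[OF \<tau>] by (simp only: inj_eq)
    define k where "k = (j + 1) div 2"
    have "k \<in> {1..m}"
      using ij(2) unfolding k_def by auto
    from \<tau>_range[OF this] have "2 * \<tau> k - 1 \<noteq> 2 * \<tau> k"
      by auto
    moreover have "(if odd i \<longleftrightarrow> k \<notin> T then 2 * \<tau> k - 1 else 2 * \<tau> k) =
        (if odd j \<longleftrightarrow> k \<notin> T then 2 * \<tau> k - 1 else 2 * \<tau> k)"
      using ij(3) unfolding domino_perm_def block k_def .
    ultimately have "odd i \<longleftrightarrow> odd j"
      by metis
    with block show "i = j"
      by presburger
  qed
  have range: "domino_perm \<tau> T ` {1..2 * m} \<subseteq> {1..2 * m}"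
  proof (rule image_subsetI)
    fix j assume "j \<in> {1..2 * m}"
    then have "(j + 1) div 2 \<in> {1..m}"
      by auto
    then have "\<tau> ((j + 1) div 2) \<in> {1..m}"
      by (rule \<tau>_range)
    then have "2 * \<tau> ((j + 1) div 2) - 1 \<in> {1..2 * m}" "2 * \<tau> ((j + 1) div 2) \<in> {1..2 * m}"
      unfolding atLeastAtMost_iff by linarith+
    then show "domino_perm \<tau> T j \<in> {1..2 * m}"
      unfolding domino_perm_def by presburger
  qed
  have fixed: "domino_perm \<tau> T j = j" if "j \<notin> {1..2 * m}" for j
  proof -
    have "(j + 1) div 2 \<notin> {1..m}"
      using that by auto
    then have "\<tau> ((j + 1) div 2) = (j + 1) div 2" "(j + 1) div 2 \<notin> T"
      using permutes_not_in[OF \<tau>] T by auto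
    then have "domino_perm \<tau> T j = (if odd j then 2 * ((j + 1) div 2) - 1 else 2 * ((j + 1) div 2))"
      by (simp only: domino_perm_def simp_thms if_True not_False_eq_True)
    also have "\<dots> = j"
      by presburger
    finally show ?thesis .
  qed
  have "bij_betw (domino_perm \<tau> T) {1..2 * m} {1..2 * m}"
    using inj endo_inj_surj[OF finite_atLeastAtMost range inj] by (rule bij_betw_imageI)
  then show ?thesis
    using fixed by (rule bij_imp_permutes)
qed

lemma domino_perm_not_split:
  assumes "\<tau> permutes {1..m}" "k \<ge> 1"
  shows "\<not> split_pair (domino_perm \<tau> T) k"
proof
  assume "split_pair (domino_perm \<tau> T) k"
  then obtain a b where ab: "domino_perm \<tau> T a = 2 * k - 1" "domino_perm \<tau> T b = 2 * k"
    "Suc a \<noteq> b" "Suc b \<noteq> a"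
    unfolding split_pair_def by blast
  have "\<tau> ((a + 1) div 2) = \<tau> ((b + 1) div 2)"
    using ab(1,2) assms(2) block_domino_perm[of \<tau> T a] block_domino_perm[of \<tau> T b] by auto
  then have "(a + 1) div 2 = (b + 1) div 2"
    using permutes_inj[OF assms(1)] by (simp only: inj_eq)
  moreover have "a \<noteq> b"
    using ab(1,2) assms(2) by auto
  ultimately show False
    using ab(3,4) by presburger
qed

lemma inj_on_domino_perm:
  "inj_on (\<lambda>(\<tau>, T). domino_perm \<tau> T) ({\<tau>. \<tau> permutes {1..m}} \<times> Pow {1..m})"
proof (rule inj_onI, clarify)
  fix \<tau> T \<tau>' T'
  assume \<tau>: "\<tau> permutes {1..m}" "\<tau>' permutes {1..m}" and T: "T \<subseteq> {1..m}" "T' \<subseteq> {1..m}"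
    and eq: "domino_perm \<tau> T = domino_perm \<tau>' T'"
  have \<tau>_eq: "\<tau> i = \<tau>' i" for i
    using block_domino_perm[of \<tau> T "2 * i"] block_domino_perm[of \<tau>' T' "2 * i"] eq by simp
  moreover have "i \<in> T \<longleftrightarrow> i \<in> T'" if "i \<in> {1..m}" for i
  proof -
    have "\<tau> i \<ge> 1"
      using permutes_in_image[OF \<tau>(1)] that by auto
    then show ?thesis
      using fun_cong[OF eq, of "2 * i"] \<tau>_eq[of i] by (auto simp: domino_perm_even split: if_splits)
  qed
  ultimately show "\<tau> = \<tau>' \<and> T = T'"
    using T by blast
qed

text \<open>Uniqueness of the domino tiling: position \<open>2 * i - 1\<close> has its partner on the left or on the
  right, but the position on its left is already taken by the previous domino.\<close>

lemma unsplit_imp_blocks: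
  assumes \<sigma>: "\<sigma> permutes {1..2 * m}" and unsplit: "\<And>k. k \<in> {1..m} \<Longrightarrow> \<not> split_pair \<sigma> k"
    and "i \<in> {1..m}"
  shows "(\<sigma> (2 * i - 1) + 1) div 2 = (\<sigma> (2 * i) + 1) div 2"
  using assms(3)
proof (induction i rule: less_induct)
  case (less i)
  let ?a = "2 * i - 1"
  obtain k where k_def: "k = (\<sigma> ?a + 1) div 2"
    by blast
  have "?a \<in> {1..2 * m}"
    using less.prems by auto
  then have "\<sigma> ?a \<in> {1..2 * m}"
    using permutes_in_image[OF \<sigma>] by blast
  then have k: "k \<in> {1..m}"
    unfolding k_def by auto
  then have k_range: "2 * k - 1 \<in> {1..2 * m}" "2 * k \<in> {1..2 * m}"
    by auto
  obtain c d where cd: "\<sigma> c = 2 * k - 1" "\<sigma> d = 2 * k"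
    by (metis permutes_surj[OF \<sigma>] surjD)
  have adj: "Suc c = d \<or> Suc d = c"
    using unsplit[OF k] cd unfolding split_pair_def by blast
  \<comment> \<open>The positions \<open>c\<close> and \<open>d\<close> are the only ones whose value lies in pair \<open>k\<close>.\<close>
  have only: "x = c \<or> x = d" if "(\<sigma> x + 1) div 2 = k" for x
  proof -
    have "\<sigma> x = \<sigma> c \<or> \<sigma> x = \<sigma> d"
      using that cd k by presburger
    then show ?thesis
      using permutes_inj[OF \<sigma>] by (simp add: inj_eq)
  qed
  have block: "(\<sigma> c + 1) div 2 = k" "(\<sigma> d + 1) div 2 = k"
    using cd k by simp_all
  have cd_range: "c \<ge> 1" "d \<ge> 1"
    using permutes_in_image[OF \<sigma>] k_range cd by (metis atLeastAtMost_iff)+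
  show ?case
  proof (rule ccontr)
    assume ne: "\<not> ?thesis"
    then have "2 * i \<noteq> c" "2 * i \<noteq> d"
      using block k_def by auto
    moreover have "?a = c \<or> ?a = d"
      using only[OF k_def[symmetric]] .
    ultimately have "c = ?a \<and> d = 2 * (i - 1) \<or> d = ?a \<and> c = 2 * (i - 1)"
      using adj by auto
    then have prev: "{c, d} = {?a, 2 * (i - 1)}" and i: "i \<ge> 2"
      using cd_range by auto
    \<comment> \<open>Otherwise pair \<open>k\<close> would occupy both positions of domino \<open>i - 1\<close> and position \<open>2 * i - 1\<close>.\<close>
    have "i - 1 < i" "i - 1 \<in> {1..m}"
      using i less.prems by auto
    then have "(\<sigma> (2 * (i - 1) - 1) + 1) div 2 = (\<sigma> (2 * (i - 1)) + 1) div 2"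
      by (rule less.IH)
    also have "\<dots> = k"
      using block prev by (auto simp: doubleton_eq_iff)
    finally have "(\<sigma> (2 * (i - 1) - 1) + 1) div 2 = k" .
    then have "2 * (i - 1) - 1 \<in> {?a, 2 * (i - 1)}"
      using only prev by blast
    then show False
      using i by auto
  qed
qed

text \<open>Hence \<open>\<tau>\<close> can be read off from the even positions, and \<open>T\<close> from the order within each domino.\<close>

lemma unsplit_imp_domino_perm:
  assumes \<sigma>: "\<sigma> permutes {1..2 * m}" and unsplit: "\<And>k. k \<in> {1..m} \<Longrightarrow> \<not> split_pair \<sigma> k"
  obtains \<tau> T where "\<tau> permutes {1..m}" "T \<subseteq> {1..m}" "\<sigma> = domino_perm \<tau> T"
proof -
  define \<tau> where "\<tau> i = (if i \<in> {1..m} then (\<sigma> (2 * i) + 1) div 2 else i)" for i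
  define T where "T = {i \<in> {1..m}. \<sigma> (2 * i - 1) > \<sigma> (2 * i)}"
  have range: "\<sigma> j \<in> {1..2 * m}" if "j \<in> {1..2 * m}" for j
    using permutes_in_image[OF \<sigma>] that by blast
  have pair_values: "\<tau> i \<ge> 1 \<and> {\<sigma> (2 * i - 1), \<sigma> (2 * i)} = {2 * \<tau> i - 1, 2 * \<tau> i}"
    if i: "i \<in> {1..m}" for i
  proof -
    have "\<sigma> (2 * i - 1) \<noteq> \<sigma> (2 * i)"
      using i permutes_inj[OF \<sigma>] by (auto simp: inj_eq)
    moreover have "(\<sigma> (2 * i - 1) + 1) div 2 = \<tau> i" "(\<sigma> (2 * i) + 1) div 2 = \<tau> i"
      using unsplit_imp_blocks[OF \<sigma> unsplit i] i by (auto simp: \<tau>_def)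
    moreover have "2 * i - 1 \<in> {1..2 * m}" "2 * i \<in> {1..2 * m}"
      using i by auto
    then have "\<sigma> (2 * i - 1) \<ge> 1" "\<sigma> (2 * i) \<ge> 1"
      using range by (metis atLeastAtMost_iff)+
    moreover have "t \<ge> 1 \<and> {u, v} = {2 * t - 1, 2 * t}"
      if "u \<noteq> v" "(u + 1) div 2 = t" "(v + 1) div 2 = t" "u \<ge> 1" "v \<ge> 1" for u v t :: nat
    proof -
      have "u = 2 * t - 1 \<and> v = 2 * t \<or> u = 2 * t \<and> v = 2 * t - 1" "t \<ge> 1"
        using that by presburger+
      then show ?thesis
        by auto
    qed
    ultimately show ?thesis
      by blast
  qed
  have "\<tau> permutes {1..m}"
  proof -
    have inj: "inj_on \<tau> {1..m}"
    proof (rule inj_onI)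
      fix i j assume ij: "i \<in> {1..m}" "j \<in> {1..m}" "\<tau> i = \<tau> j"
      have "\<sigma> (2 * j) \<in> {\<sigma> (2 * i - 1), \<sigma> (2 * i)}"
        using pair_values[OF ij(1)] pair_values[OF ij(2)] ij(3) by auto
      then have "2 * j = 2 * i - 1 \<or> 2 * j = 2 * i"
        using permutes_inj[OF \<sigma>] by (auto simp: inj_eq)
      then show "i = j"
        using ij by auto
    qed
    have "\<tau> ` {1..m} \<subseteq> {1..m}"
    proof (rule image_subsetI)
      fix i assume i: "i \<in> {1..m}"
      then have "\<sigma> (2 * i) \<in> {1..2 * m}"
        by (intro range) auto
      then show "\<tau> i \<in> {1..m}"
        using i by (auto simp: \<tau>_def)
    qed
    with inj have "bij_betw \<tau> {1..m} {1..m}"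
      by (simp add: bij_betw_def endo_inj_surj)
    then show ?thesis
      by (rule bij_imp_permutes) (simp only: \<tau>_def if_False)
  qed
  moreover have T: "T \<subseteq> {1..m}"
    by (auto simp: T_def)
  moreover have "\<sigma> = domino_perm \<tau> T"
  proof
    fix j
    show "\<sigma> j = domino_perm \<tau> T j"
    proof (cases "j \<in> {1..2 * m}")
      case False
      then show ?thesis
        using permutes_not_in[OF \<sigma>] permutes_not_in[OF domino_perm_permutes[OF \<open>\<tau> permutes _\<close> T]]
        by simp
    next
      case True
      define i where "i = (j + 1) div 2"
      have i: "i \<in> {1..m}" and j: "j = 2 * i - 1 \<or> j = 2 * i"
        using True unfolding i_def by auto
      show ?thesis
        using j pair_values[OF i] i
        by (auto simp: domino_perm_odd domino_perm_even T_def doubleton_eq_iff)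
    qed
  qed
  ultimately show thesis
    by (rule that)
qed

lemma descents_domino_perm:
  assumes \<tau>: "\<tau> permutes {1..m}" and T: "T \<subseteq> {1..m}"
  shows "odd_descents (2 * m) (domino_perm \<tau> T) = (\<lambda>i. 2 * i - 1) ` T"
    and "even_descents (2 * m) (domino_perm \<tau> T) = (\<lambda>i. 2 * i) ` descents m \<tau>"
proof -
  have pos: "\<tau> i \<ge> 1" if "i \<in> {1..m}" for i
    using permutes_in_image[OF \<tau>] that by auto
  have odd_pos: "2 * i - 1 \<in> descents (2 * m) (domino_perm \<tau> T) \<longleftrightarrow> i \<in> T" if i: "i \<in> {1..m}" for i
  proof -
    have "2 * i - 1 + 1 = 2 * i" "2 * i - 1 \<in> {1..2 * m - 1}"
      "domino_perm \<tau> T (2 * i - 1) = (if i \<in> T then 2 * \<tau> i else 2 * \<tau> i - 1)"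
      using i domino_perm_odd[of i \<tau> T] by auto
    then have "2 * i - 1 \<in> descents (2 * m) (domino_perm \<tau> T) \<longleftrightarrow>
        (if i \<in> T then 2 * \<tau> i - 1 else 2 * \<tau> i) < (if i \<in> T then 2 * \<tau> i else 2 * \<tau> i - 1)"
      by (simp only: descents_def mem_Collect_eq domino_perm_even simp_thms)
    then show ?thesis
      using pos[OF i] by (cases "i \<in> T") simp_all
  qed
  have even_pos: "2 * i \<in> descents (2 * m) (domino_perm \<tau> T) \<longleftrightarrow> i \<in> descents m \<tau>"
    if "i \<ge> 1" for i
  proof (cases "i < m")
    case True
    have "\<tau> i \<noteq> \<tau> (i + 1)"
      using permutes_inj[OF \<tau>] by (simp add: inj_eq)
    moreover have "2 * i + 1 = 2 * (i + 1) - 1"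
      by simp
    ultimately show ?thesis
      using that True pos[of i] pos[of "i + 1"] domino_perm_odd[of "i + 1" \<tau> T]
      unfolding descents_def by (auto simp: domino_perm_even)
  next
    case False
    then show ?thesis
      using that by (auto simp: descents_def)
  qed
  show "odd_descents (2 * m) (domino_perm \<tau> T) = (\<lambda>i. 2 * i - 1) ` T"
  proof (intro equalityI subsetI)
    fix j assume j: "j \<in> odd_descents (2 * m) (domino_perm \<tau> T)"
    define i where "i = (j + 1) div 2"
    have "j = 2 * i - 1" "i \<in> {1..m}"
      using j unfolding i_def by (auto simp: odd_descents_def descents_def)
    then show "j \<in> (\<lambda>i. 2 * i - 1) ` T"
      using j odd_pos by (auto simp: odd_descents_def)
  next
    fix j assume "j \<in> (\<lambda>i. 2 * i - 1) ` T"
    then show "j \<in> odd_descents (2 * m) (domino_perm \<tau> T)"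
      using odd_pos T by (auto simp: odd_descents_def)
  qed
  show "even_descents (2 * m) (domino_perm \<tau> T) = (\<lambda>i. 2 * i) ` descents m \<tau>"
  proof (intro equalityI subsetI)
    fix j assume j: "j \<in> even_descents (2 * m) (domino_perm \<tau> T)"
    define i where "i = j div 2"
    have "j = 2 * i" "i \<ge> 1"
      using j unfolding i_def by (auto simp: even_descents_def descents_def)
    then show "j \<in> (\<lambda>i. 2 * i) ` descents m \<tau>"
      using j even_pos by (auto simp: even_descents_def)
  next
    fix j assume "j \<in> (\<lambda>i. 2 * i) ` descents m \<tau>"
    then show "j \<in> even_descents (2 * m) (domino_perm \<tau> T)"
      using even_pos by (auto simp: even_descents_def descents_def[of m])
  qed
qed

text \<open>Two positions in different dominoes compare as \<open>\<tau>\<close> compares the dominoes, so each inversion of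
  \<open>\<tau>\<close> accounts for all \<open>2 * 2\<close> pairs of positions between its two dominoes. Inside a domino
  there is an inversion exactly when the domino belongs to \<open>T\<close>.\<close>

lemma inv_length_domino_perm:
  assumes \<tau>: "\<tau> permutes {1..m}" and T: "T \<subseteq> {1..m}"
  shows "inv_length (2 * m) (domino_perm \<tau> T) = card T + 4 * inv_length m \<tau>"
proof -
  let ?\<sigma> = "domino_perm \<tau> T"
  let ?in = "(\<lambda>i. (2 * i - 1, 2 * i)) ` T"
  \<comment> \<open>The bit \<open>a\<close> selects one of the two positions \<open>2 * i - 1\<close> and \<open>2 * i\<close> of domino \<open>i\<close>.\<close>
  let ?f = "\<lambda>((i, j), (a, b)). (2 * i - a, 2 * j - b)"
  let ?D = "inversions m \<tau> \<times> ({0, 1} \<times> {0, 1 :: nat})"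
  have pos: "\<tau> i \<ge> 1" if "i \<in> {1..m}" for i
    using permutes_in_image[OF \<tau>] that by auto
  have across: "?\<sigma> j < ?\<sigma> i \<longleftrightarrow> \<tau> ((j + 1) div 2) < \<tau> ((i + 1) div 2)"
    if "(i + 1) div 2 \<noteq> (j + 1) div 2" for i j
  proof -
    have "\<tau> ((i + 1) div 2) \<noteq> \<tau> ((j + 1) div 2)"
      using that permutes_inj[OF \<tau>] by (simp only: inj_eq not_False_eq_True)
    then show ?thesis
      using block_domino_perm[of \<tau> T i] block_domino_perm[of \<tau> T j] by linarith
  qed
  have "inversions (2 * m) ?\<sigma> = ?in \<union> ?f ` ?D"
  proof (intro equalityI subsetI)
    fix p assume p: "p \<in> inversions (2 * m) ?\<sigma>"
    obtain i j where ij: "p = (i, j)" "i \<in> {1..2 * m}" "j \<in> {1..2 * m}" "i < j" "?\<sigma> i > ?\<sigma> j"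
      using p unfolding inversions_def by auto
    define k l where "k = (i + 1) div 2" and "l = (j + 1) div 2"
    have kl: "k \<in> {1..m}" "l \<in> {1..m}" "k \<le> l" "i = 2 * k - (if odd i then 1 else 0)"
      "j = 2 * l - (if odd j then 1 else 0)"
      using ij(2,3,4) unfolding k_def l_def by (auto elim!: oddE evenE)
    show "p \<in> ?in \<union> ?f ` ?D"
    proof (cases "k = l")
      case True
      then have same: "i = 2 * k - 1" "j = 2 * k"
        using kl ij(4) by (auto split: if_splits)
      then have "k \<in> T"
        using ij(5) kl(1) by (auto simp: domino_perm_odd domino_perm_even split: if_splits)
      then show ?thesis
        using ij(1) same by auto
    next
      case False
      then have "(k, l) \<in> inversions m \<tau>"
        using kl across[of i j] ij(5) by (auto simp: inversions_def k_def l_def)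
      then have "?f ((k, l), (if odd i then 1 else 0, if odd j then 1 else 0)) \<in> ?f ` ?D"
        by (intro imageI) auto
      then show ?thesis
        using kl(4,5) ij(1) by (simp split del: if_split)
    qed
  next
    fix p assume "p \<in> ?in \<union> ?f ` ?D"
    then consider (same) i where "i \<in> T" "p = (2 * i - 1, 2 * i)"
      | (diff) i j a b where "(i, j) \<in> inversions m \<tau>" "a \<in> {0, 1}" "b \<in> {0, 1}"
          "p = (2 * i - a, 2 * j - b)"
      by force
    then show "p \<in> inversions (2 * m) ?\<sigma>"
    proof cases
      case same
      then have "i \<in> {1..m}"
        using T by blast
      then show ?thesis
        using same pos[of i] by (auto simp: inversions_def domino_perm_odd domino_perm_even)
    next
      case diff
      then have blocks: "(2 * i - a + 1) div 2 = i" "(2 * j - b + 1) div 2 = j"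
        and ij: "i \<in> {1..m}" "j \<in> {1..m}" "i < j" "\<tau> j < \<tau> i"
        by (auto simp: inversions_def)
      have "?\<sigma> (2 * j - b) < ?\<sigma> (2 * i - a)"
        using across[of "2 * i - a" "2 * j - b"] ij unfolding blocks by simp
      then show ?thesis
        using diff(2-4) ij by (auto simp: inversions_def)
    qed
  qed
  moreover have "?in \<inter> ?f ` ?D = {}"
    using T by (auto simp: inversions_def, presburger+)
  moreover have "card ?in = card T"
    by (rule card_image) (auto simp: inj_on_def)
  moreover have "card (?f ` ?D) = 4 * inv_length m \<tau>"
  proof -
    have parity: "i = i' \<and> a = a'"
      if "2 * i - a = 2 * i' - a'" "i \<ge> 1" "i' \<ge> 1" "a \<in> {0, 1}" "a' \<in> {0, 1}"
      for i i' a a' :: nat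
    proof -
      have "(2 * i - a + 1) div 2 = i" "(2 * i' - a' + 1) div 2 = i'"
        using that(2-) by auto
      then have "i = i'"
        using that(1) by simp
      then show ?thesis
        using that by auto
    qed
    have "inj_on ?f ?D"
    proof (rule inj_onI)
      fix p p' assume p: "p \<in> ?D" "p' \<in> ?D" "?f p = ?f p'"
      obtain i j a b i' j' a' b' where pp: "p = ((i, j), (a, b))" "p' = ((i', j'), (a', b'))"
        by (metis surj_pair)
      have ge: "i \<ge> 1" "j \<ge> 1" "i' \<ge> 1" "j' \<ge> 1"
        using p unfolding pp inversions_def by simp_all
      have bits: "a \<in> {0, 1}" "b \<in> {0, 1}" "a' \<in> {0, 1}" "b' \<in> {0, 1}"
        and eq: "2 * i - a = 2 * i' - a'" "2 * j - b = 2 * j' - b'"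
        using p unfolding pp by (simp_all only: mem_Times_iff fst_conv snd_conv prod.case prod.inject)
      show "p = p'"
        using parity[OF eq(1) ge(1,3) bits(1,3)] parity[OF eq(2) ge(2,4) bits(2,4)]
        unfolding pp by simp
    qed
    then show ?thesis
      by (simp add: card_image inv_length_def card_cartesian_product)
  qed
  moreover have "finite ?in" "finite (?f ` ?D)"
    using finite_subset[OF T] by simp_all
  ultimately show ?thesis
    unfolding inv_length_def[of "2 * m"] by (simp add: card_Un_disjoint)
qed

lemma weight_domino_perm:
  fixes q1 q2 x1 x2 :: "'a::comm_ring_1"
  assumes "\<tau> permutes {1..m}" "T \<subseteq> {1..m}"
  shows "weight q1 q2 x1 x2 (2 * m) (domino_perm \<tau> T)
    = (\<Prod>i\<in>T. - (x1 * q1 ^ i)) * (q2 ^ maj m \<tau> * x2 ^ des m \<tau>)"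
proof -
  have inj_odd: "inj_on (\<lambda>i. 2 * i - 1) T"
    using assms(2) by (auto simp: inj_on_def subset_eq)
  have inj_even: "inj_on (\<lambda>i::nat. 2 * i) A" for A
    by (auto simp: inj_on_def)
  have "omaj (2 * m) (domino_perm \<tau> T) = \<Sum>T"
    using assms(2) unfolding omaj_def descents_domino_perm(1)[OF assms]
    by (subst sum.reindex[OF inj_odd]) (auto intro!: sum.cong)
  moreover have "odes (2 * m) (domino_perm \<tau> T) = card T"
    unfolding odes_def descents_domino_perm(1)[OF assms] by (rule card_image[OF inj_odd])
  moreover have "emaj (2 * m) (domino_perm \<tau> T) = maj m \<tau>"
    by (simp add: emaj_def descents_domino_perm(2)[OF assms] sum.reindex inj_even maj_def)
  moreover have "edes (2 * m) (domino_perm \<tau> T) = des m \<tau>"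
    by (simp add: edes_def descents_domino_perm(2)[OF assms] card_image inj_even des_def)
  moreover have "(\<Prod>i\<in>T. - (x1 * q1 ^ i)) = (-1) ^ card T * q1 ^ \<Sum>T * x1 ^ card T"
  proof -
    have "(\<Prod>i\<in>T. - (x1 * q1 ^ i)) = (\<Prod>i\<in>T. (-1) * q1 ^ i * x1)"
      by (simp add: mult.commute)
    then show ?thesis
      by (simp only: prod.distrib prod_constant power_sum)
  qed
  moreover have "(-1) ^ inv_length (2 * m) (domino_perm \<tau> T) = ((-1) ^ card T :: 'a)"
    by (simp add: inv_length_domino_perm[OF assms] power_add)
  ultimately show ?thesis
    unfolding weight_def by (simp only: mult_ac)
qed

lemma bij_betw_domino_perm:
  assumes J: "J \<subseteq> {1..2 * m - 1}"
  shows "bij_betw (\<lambda>(\<tau>, T). domino_perm \<tau> T)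
    (sym_quot m (even_half J) \<times> Pow {i \<in> {1..m}. 2 * i - 1 \<notin> J})
    {\<sigma> \<in> sym_quot (2 * m) J. \<forall>k\<in>{1..m}. \<not> split_pair \<sigma> k}"
    (is "bij_betw ?f ?A ?B")
proof -
  have half: "even_half J \<subseteq> {1..m - 1}"
    using J by (force simp: even_half_def elim!: evenE)
  have iff: "domino_perm \<tau> T \<in> sym_quot (2 * m) J \<longleftrightarrow>
    \<tau> \<in> sym_quot m (even_half J) \<and> T \<subseteq> {i \<in> {1..m}. 2 * i - 1 \<notin> J}"
    if "\<tau> permutes {1..m}" "T \<subseteq> {1..m}" for \<tau> T
  proof -
    have "descents (2 * m) (domino_perm \<tau> T)
      = (\<lambda>i. 2 * i - 1) ` T \<union> (\<lambda>i. 2 * i) ` descents m \<tau>"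
      unfolding descents_domino_perm[OF that, symmetric] odd_descents_def even_descents_def by blast
    then have "descents (2 * m) (domino_perm \<tau> T) \<inter> J = {} \<longleftrightarrow>
      (\<forall>i\<in>T. 2 * i - 1 \<notin> J) \<and> (\<forall>i\<in>descents m \<tau>. 2 * i \<notin> J)"
      by auto
    moreover have "2 * i \<in> J \<longleftrightarrow> i \<in> even_half J" for i
      by (force simp: even_half_def elim!: evenE)
    ultimately show ?thesis
      using that domino_perm_permutes[OF that] by (auto simp: sym_quot_eq[OF J] sym_quot_eq[OF half])
  qed
  have "inj_on ?f ?A"
    by (rule inj_on_subset[OF inj_on_domino_perm[of m]]) (auto simp: sym_quot_def)
  moreover have "?f ` ?A = ?B"
  proof (intro equalityI subsetI)
    fix \<sigma> assume "\<sigma> \<in> ?f ` ?A"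
    then obtain \<tau> T where *: "\<tau> \<in> sym_quot m (even_half J)" "T \<subseteq> {i \<in> {1..m}. 2 * i - 1 \<notin> J}"
      "\<sigma> = domino_perm \<tau> T"
      by auto
    then have "\<tau> permutes {1..m}" "T \<subseteq> {1..m}"
      by (auto simp: sym_quot_def)
    with * iff show "\<sigma> \<in> ?B"
      using domino_perm_not_split by auto
  next
    fix \<sigma> assume \<sigma>: "\<sigma> \<in> ?B"
    then obtain \<tau> T where *: "\<tau> permutes {1..m}" "T \<subseteq> {1..m}" "\<sigma> = domino_perm \<tau> T"
      using unsplit_imp_domino_perm[of \<sigma> m] by (auto simp: sym_quot_def)
    then have "(\<tau>, T) \<in> ?A"
      using iff \<sigma> by auto
    then show "\<sigma> \<in> ?f ` ?A"
      using *(3) by (intro image_eqI[of _ _ "(\<tau>, T)"]) auto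
  qed
  ultimately show ?thesis
    by (simp add: bij_betw_def)
qed

section \<open>The generating function\<close>

theorem theorem3p8:
  fixes q1 q2 x1 x2 :: "'a::comm_ring_1" and m :: nat and J :: "nat set"
  assumes "m \<ge> 1" and "J \<subseteq> {1..2 * m - 1}"
  shows "(\<Sum>\<sigma>\<in>sym_quot (2 * m) J.
            (-1) ^ inv_length (2 * m) \<sigma> * q1 ^ omaj (2 * m) \<sigma> * q2 ^ emaj (2 * m) \<sigma>
              * x1 ^ odes (2 * m) \<sigma> * x2 ^ edes (2 * m) \<sigma>)
       = (\<Prod>i\<in>{i \<in> {1..m}. 2 * i - 1 \<notin> J}. 1 - x1 * q1 ^ i)
           * (\<Sum>\<tau>\<in>sym_quot m (even_half J). q2 ^ maj m \<tau> * x2 ^ des m \<tau>)"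
proof -
  let ?w = "weight q1 q2 x1 x2 (2 * m)"
  let ?S = "sym_quot (2 * m) J" and ?S' = "sym_quot m (even_half J)"
  let ?I = "{i \<in> {1..m}. 2 * i - 1 \<notin> J}"
  define X where "X = {\<sigma> \<in> ?S. \<exists>k\<in>{1..m}. split_pair \<sigma> k}"
  define Y where "Y = {\<sigma> \<in> ?S. \<forall>k\<in>{1..m}. \<not> split_pair \<sigma> k}"
  have "?S = X \<union> Y" "X \<inter> Y = {}"
    unfolding X_def Y_def by blast+
  moreover have "finite X" "finite Y"
    unfolding X_def Y_def using finite_sym_quot[of "2 * m" J] by simp_all
  ultimately have "sum ?w ?S = sum ?w X + sum ?w Y"
    by (simp only: sum.union_disjoint)
  also have "\<dots> = sum ?w Y"
    unfolding X_def by (simp only: sum_weight_split_eq_0[OF assms(2)] add_0_left)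
  also have "\<dots> = (\<Sum>p\<in>?S' \<times> Pow ?I. ?w (case p of (\<tau>, T) \<Rightarrow> domino_perm \<tau> T))"
    unfolding Y_def by (rule sum.reindex_bij_betw[OF bij_betw_domino_perm[OF assms(2)], symmetric])
  also have "\<dots> = (\<Sum>(\<tau>, T)\<in>?S' \<times> Pow ?I.
    (\<Prod>i\<in>T. - (x1 * q1 ^ i)) * (q2 ^ maj m \<tau> * x2 ^ des m \<tau>))"
  proof (rule sum.cong[OF refl])
    fix p assume "p \<in> ?S' \<times> Pow ?I"
    then obtain \<tau> T where p: "p = (\<tau>, T)" "\<tau> \<in> ?S'" "T \<subseteq> ?I"
      by blast
    then have "\<tau> permutes {1..m}" "T \<subseteq> {1..m}"
      by (auto simp: sym_quot_def)
    then show "?w (case p of (\<tau>, T) \<Rightarrow> domino_perm \<tau> T)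
      = (case p of (\<tau>, T) \<Rightarrow> (\<Prod>i\<in>T. - (x1 * q1 ^ i)) * (q2 ^ maj m \<tau> * x2 ^ des m \<tau>))"
      unfolding p by (simp only: prod.case weight_domino_perm)
  qed
  also have "\<dots> = (\<Sum>\<tau>\<in>?S'. \<Sum>T\<in>Pow ?I.
    (\<Prod>i\<in>T. - (x1 * q1 ^ i)) * (q2 ^ maj m \<tau> * x2 ^ des m \<tau>))"
    by (rule sum.cartesian_product[symmetric])
  also have "\<dots> = (\<Sum>T\<in>Pow ?I. \<Prod>i\<in>T. - (x1 * q1 ^ i))
    * (\<Sum>\<tau>\<in>?S'. q2 ^ maj m \<tau> * x2 ^ des m \<tau>)"
    by (simp only: sum_distrib_left sum_distrib_right)
  also have "(\<Sum>T\<in>Pow ?I. \<Prod>i\<in>T. - (x1 * q1 ^ i)) = (\<Prod>i\<in>?I. 1 - x1 * q1 ^ i)"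
    using prod_add[of ?I "\<lambda>i. - (x1 * q1 ^ i)" "\<lambda>_. 1"] by simp
  finally show ?thesis
    by (simp only: weight_def)
qed

end
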